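(* For the game $\mathrm{CN}(6,3)$, the set of losing positions is $$\mathcal{L}=\{(a,b,c,d,e,f)\mid a+b=d+e \text{ and } b+c=e+f\},$$ where $a,b,c,d,e,f$ range over the non-negative integers.
   Context: For integers $1\le k\le n$, circular Nim $\mathrm{CN}(n,k)$ is the following two-player impartial game. A position is a vector $\mathbf p=(p_1,\ldots,p_n)$ of non-negative integers, the heights of $n$ stacks of tokens placed in a circle in this order (indices modulo $n$). A legal move consists of choosing $k$ cyclically consecutive stacks $i,i+1,\ldots,i+k-1$ (modulo $n$) and removing $a_j$ tokens, $0\le a_j\le p_j$, from each chosen stack $j$, with at least one token removed in total. Players alternate; a player who cannot move loses. A position is losing (belongs to $\mathcal{L}$) if the player about to move from it loses under optimal play by the opponent; equivalently, $\mathcal{L}$ is the set of positions none of whose options (positions reachable by one legal move) lies in $\mathcal{L}$. *)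

theory Defs
  imports Main
begin

text \<open>Circular Nim $CN(n,k)$. A position is the list of the \<open>n\<close> stack heights; stacks are
  indexed from \<open>0\<close>, and index arithmetic is modulo \<open>n\<close>.\<close>

definition cn_positions :: "nat \<Rightarrow> nat list set" where
  "cn_positions n = {p. length p = n}"

definition cn_arc :: "nat \<Rightarrow> nat \<Rightarrow> nat \<Rightarrow> nat set" where
  "cn_arc n k i = {(i + t) mod n | t. t < k}"

definition cn_move :: "nat \<Rightarrow> nat \<Rightarrow> nat list \<Rightarrow> nat list \<Rightarrow> bool" where
  "cn_move n k p q \<longleftrightarrow> p \<in> cn_positions n \<and>
     (\<exists>i<n. \<exists>a :: nat \<Rightarrow> nat.
        (\<forall>j \<in> cn_arc n k i. a j \<le> p ! j) \<and>
        (\<exists>j \<in> cn_arc n k i. 0 < a j) \<and>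
        q = map (\<lambda>j. if j \<in> cn_arc n k i then p ! j - a j else p ! j) [0..<n])"

text \<open>Outcomes for the player about to move. The least fixed point is the right one because
  every play is finite (lemma \<open>cn_move_sum_list\<close>).\<close>

inductive cn_losing :: "nat \<Rightarrow> nat \<Rightarrow> nat list \<Rightarrow> bool"
  and cn_winning :: "nat \<Rightarrow> nat \<Rightarrow> nat list \<Rightarrow> bool"
  for n k :: nat
where
  losing: "p \<in> cn_positions n \<Longrightarrow> (\<And>q. cn_move n k p q \<Longrightarrow> cn_winning n k q) \<Longrightarrow> cn_losing n k p"
| winning: "cn_move n k p q \<Longrightarrow> cn_losing n k q \<Longrightarrow> cn_winning n k p"

definition cn_losing_positions :: "nat \<Rightarrow> nat \<Rightarrow> nat list set" where
  "cn_losing_positions n k = {p. cn_losing n k p}"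

lemma cn_move_position:
  assumes "cn_move n k p q"
  shows "q \<in> cn_positions n"
  using assms by (auto simp: cn_move_def cn_positions_def)

lemma cn_move_sum_list:
  assumes "cn_move n k p q"
  shows "sum_list q < sum_list p"
proof -
  from assms obtain i a where len: "length p = n" and "i < n"
    and le: "\<forall>j \<in> cn_arc n k i. a j \<le> p ! j" and ex: "\<exists>j \<in> cn_arc n k i. 0 < a j"
    and q: "q = map (\<lambda>j. if j \<in> cn_arc n k i then p ! j - a j else p ! j) [0..<n]"
    unfolding cn_move_def cn_positions_def by blast
  have arc: "cn_arc n k i \<subseteq> {0..<n}"
    using \<open>i < n\<close> by (auto simp: cn_arc_def)
  let ?g = "\<lambda>j. if j \<in> cn_arc n k i then p ! j - a j else p ! j"
  have "sum_list q = (\<Sum>j\<in>{0..<n}. ?g j)"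
    unfolding q by (subst interv_sum_list_conv_sum_set_nat) simp
  also have "\<dots> < (\<Sum>j\<in>{0..<n}. p ! j)"
  proof (rule sum_strict_mono_ex1)
    from ex obtain j where j: "j \<in> cn_arc n k i" "0 < a j" by blast
    with le have "?g j < p ! j" by fastforce
    with j arc show "\<exists>j\<in>{0..<n}. ?g j < p ! j" by blast
  qed auto
  also have "\<dots> = sum_list p"
    using len by (simp add: sum_list_sum_nth)
  finally show ?thesis .
qed

lemma cn_winning_iff_not_losing:
  assumes "p \<in> cn_positions n"
  shows "cn_winning n k p \<longleftrightarrow> \<not> cn_losing n k p"
  using assms
proof (induction p rule: measure_induct_rule[where f = sum_list])
  case (less p)
  have IH: "cn_winning n k q \<longleftrightarrow> \<not> cn_losing n k q" if "cn_move n k p q" for q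
    using less.IH cn_move_sum_list cn_move_position that by blast
  have W: "cn_winning n k p \<longleftrightarrow> (\<exists>q. cn_move n k p q \<and> cn_losing n k q)"
    by (subst cn_winning.simps) simp
  have L: "cn_losing n k p \<longleftrightarrow> (\<forall>q. cn_move n k p q \<longrightarrow> cn_winning n k q)"
    by (subst cn_losing.simps) (simp add: less.prems)
  from W L IH show ?case by blast
qed

lemma cn_losing_positions_iff:
  "p \<in> cn_losing_positions n k \<longleftrightarrow>
     p \<in> cn_positions n \<and> (\<forall>q. cn_move n k p q \<longrightarrow> q \<notin> cn_losing_positions n k)"
proof -
  have "p \<in> cn_losing_positions n k \<longleftrightarrow>
      p \<in> cn_positions n \<and> (\<forall>q. cn_move n k p q \<longrightarrow> cn_winning n k q)"
    unfolding cn_losing_positions_def mem_Collect_eq by (subst cn_losing.simps) simp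
  then show ?thesis
    using cn_winning_iff_not_losing cn_move_position
    unfolding cn_losing_positions_def mem_Collect_eq by blast
qed

lemma cn_losing_positions_unique:
  assumes "\<And>p. p \<in> A \<longleftrightarrow> p \<in> cn_positions n \<and> (\<forall>q. cn_move n k p q \<longrightarrow> q \<notin> A)"
  shows "cn_losing_positions n k = A"
proof -
  have "p \<in> cn_losing_positions n k \<longleftrightarrow> p \<in> A" for p
  proof (induction p rule: measure_induct_rule[where f = sum_list])
    case (less p)
    have "(\<forall>q. cn_move n k p q \<longrightarrow> q \<notin> cn_losing_positions n k)
        \<longleftrightarrow> (\<forall>q. cn_move n k p q \<longrightarrow> q \<notin> A)"
      using less.IH cn_move_sum_list by blast
    then show ?case
      using cn_losing_positions_iff[of p n k] assms[of p] by blast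
  qed
  then show ?thesis by blast
qed

end

theory Submission
  imports Defs
begin

text \<open>Put \<open>x\<^sub>0 = a - d\<close>, \<open>x\<^sub>1 = e - b\<close>, \<open>x\<^sub>2 = c - f\<close>; the claimed losing positions are those with
  \<open>x\<^sub>0 = x\<^sub>1 = x\<^sub>2\<close>. Three consecutive stacks meet each opposite pair exactly once, and as the arc
  varies they realise every choice of one stack per pair except \<open>{a, c, e}\<close> and \<open>{b, d, f}\<close>. So a
  move changes each \<open>x\<^sub>i\<close> in one direction, the three directions not all being equal, and cannot
  keep the \<open>x\<^sub>i\<close> equal. Conversely all \<open>x\<^sub>i\<close> can be moved to a common value \<open>t\<close> as soon as
  \<open>min x\<^sub>i \<le> t \<le> max x\<^sub>i\<close> and \<open>- N \<le> t \<le> P\<close> for each pair, where \<open>x\<^sub>i = P - N\<close>. The larger of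
  \<open>min x\<^sub>i\<close> and \<open>max (- N)\<close> is such a \<open>t\<close>.\<close>

text \<open>The amounts removed are recovered as \<open>p ! j - q ! j\<close>, so the function
  \<open>a\<close> can be eliminated; \<open>q \<noteq> p\<close> says that some token goes.\<close>

lemma cn_move_iff:
  "cn_move n k p q \<longleftrightarrow> length p = n \<and> length q = n \<and> q \<noteq> p \<and>
     (\<forall>j<n. q ! j \<le> p ! j) \<and> (\<exists>i<n. \<forall>j<n. j \<notin> cn_arc n k i \<longrightarrow> q ! j = p ! j)"
  (is "?L \<longleftrightarrow> ?R")
proof
  assume move: ?L
  then have "q \<noteq> p"
    using cn_move_sum_list by blast
  with move show ?R
    by (fastforce simp: cn_move_def cn_positions_def)
next
  assume ?R
  then obtain i where len: "length p = n" "length q = n" and "q \<noteq> p" and "i < n"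
    and q: "\<And>j. j < n \<Longrightarrow> q ! j \<le> p ! j"
      "\<And>j. j < n \<Longrightarrow> j \<notin> cn_arc n k i \<Longrightarrow> q ! j = p ! j"
    by blast
  from \<open>q \<noteq> p\<close> len obtain j where "j < n" "q ! j \<noteq> p ! j"
    by (auto simp: list_eq_iff_nth_eq)
  then have "j \<in> cn_arc n k i" "0 < p ! j - q ! j"
    using q[of j] by auto
  moreover have "q = map (\<lambda>j. if j \<in> cn_arc n k i then p ! j - (p ! j - q ! j) else p ! j) [0..<n]"
    using len q by (intro nth_equalityI) auto
  ultimately show ?L
    unfolding cn_move_def cn_positions_def using len \<open>i < n\<close>
    by (intro conjI exI[of _ i] exI[of _ "\<lambda>j. p ! j - q ! j"]) auto
qed

lemma cn_arc_3: "cn_arc n 3 i = {i mod n, (i + 1) mod n, (i + 2) mod n}"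
proof -
  have "{..<3} = {0, 1, 2::nat}"
    by auto
  moreover have "cn_arc n 3 i = (\<lambda>t. (i + t) mod n) ` {..<3}"
    by (auto simp: cn_arc_def)
  ultimately show ?thesis
    by simp
qed

lemma all_less_6: "(\<forall>j<6. P j) \<longleftrightarrow> P 0 \<and> P 1 \<and> P 2 \<and> P 3 \<and> P 4 \<and> P (5::nat)"
  by (auto simp: numeral_eq_Suc All_less_Suc)

lemma ex_less_6: "(\<exists>j<6. P j) \<longleftrightarrow> P 0 \<or> P 1 \<or> P 2 \<or> P 3 \<or> P 4 \<or> P (5::nat)"
  using all_less_6[of "\<lambda>j. \<not> P j"] by blast

lemma cn_move_6_3_iff:
  "cn_move 6 3 [a, b, c, d, e, f] [a', b', c', d', e', f'] \<longleftrightarrow>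
     [a', b', c', d', e', f'] \<noteq> [a, b, c, d, e, f] \<and>
     a' \<le> a \<and> b' \<le> b \<and> c' \<le> c \<and> d' \<le> d \<and> e' \<le> e \<and> f' \<le> f \<and>
     (d' = d \<and> e' = e \<and> f' = f \<or> a' = a \<and> e' = e \<and> f' = f \<or> a' = a \<and> b' = b \<and> f' = f \<or>
      a' = a \<and> b' = b \<and> c' = c \<or> b' = b \<and> c' = c \<and> d' = d \<or> c' = c \<and> d' = d \<and> e' = e)"
  unfolding cn_move_iff cn_arc_3 all_less_6 ex_less_6 by simp

text \<open>Only one stack of the pair has to shrink: \<open>P\<close> to \<open>t + N\<close> if
  the difference is too large, \<open>N\<close> to \<open>P - t\<close> if it is too small. The
  bounds on \<open>t\<close> keep these sizes non-negative.\<close>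

lemma ex_pair_difference:
  fixes P N :: nat and t :: int
  assumes "- int N \<le> t" "t \<le> int P"
  shows "\<exists>P' N'. P' \<le> P \<and> N' \<le> N \<and> int P' - int N' = t \<and>
    (int P - int N \<le> t \<longrightarrow> P' = P) \<and> (t \<le> int P - int N \<longrightarrow> N' = N)"
  using assms
  by (intro exI[of _ "nat (min (int P) (t + int N))"] exI[of _ "nat (min (int N) (int P - t))"])
    auto

lemma ex_cn_move_6_3:
  fixes a b c d e f :: nat
  assumes "\<not> (a + b = d + e \<and> b + c = e + f)"
  shows "\<exists>a' b' c' d' e' f'. cn_move 6 3 [a, b, c, d, e, f] [a', b', c', d', e', f'] \<and>
    a' + b' = d' + e' \<and> b' + c' = e' + f'"
proof -
  define t where "t = max (min (int a - int d) (min (int e - int b) (int c - int f)))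
    (max (- int d) (max (- int b) (- int f)))"
  have bounds: "- int d \<le> t" "t \<le> int a" "- int b \<le> t" "t \<le> int e" "- int f \<le> t" "t \<le> int c"
    unfolding t_def by linarith+
  have above: "int a - int d \<le> t \<or> int e - int b \<le> t \<or> int c - int f \<le> t"
    unfolding t_def by linarith
  \<comment> \<open>If \<open>t\<close> is not the least difference, it is \<open>- N\<close> for
    some pair, and that pair has \<open>- N \<le> P - N\<close>.\<close>
  have below: "t \<le> int a - int d \<or> t \<le> int e - int b \<or> t \<le> int c - int f"
    unfolding t_def by linarith
  obtain a' d' where ad: "a' \<le> a" "d' \<le> d" "int a' - int d' = t"
    "int a - int d \<le> t \<longrightarrow> a' = a" "t \<le> int a - int d \<longrightarrow> d' = d"
    using ex_pair_difference[OF bounds(1,2)] by blast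
  obtain e' b' where eb: "e' \<le> e" "b' \<le> b" "int e' - int b' = t"
    "int e - int b \<le> t \<longrightarrow> e' = e" "t \<le> int e - int b \<longrightarrow> b' = b"
    using ex_pair_difference[OF bounds(3,4)] by blast
  obtain c' f' where cf: "c' \<le> c" "f' \<le> f" "int c' - int f' = t"
    "int c - int f \<le> t \<longrightarrow> c' = c" "t \<le> int c - int f \<longrightarrow> f' = f"
    using ex_pair_difference[OF bounds(5,6)] by blast
  have balanced: "a' + b' = d' + e'" "b' + c' = e' + f'"
    using ad(3) eb(3) cf(3) by linarith+
  have "a' = a \<or> d' = d" "e' = e \<or> b' = b" "c' = c \<or> f' = f"
    using ad(4,5) eb(4,5) cf(4,5) by linarith+
  \<comment> \<open>A pair with difference at most \<open>t\<close> keeps its first stack, one with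
    difference at least \<open>t\<close> its second. This excludes the two triples that are not
    arcs.\<close>
  moreover have "a' = a \<or> e' = e \<or> c' = c" "d' = d \<or> b' = b \<or> f' = f"
    using above below ad(4,5) eb(4,5) cf(4,5) by blast+
  moreover have "[a', b', c', d', e', f'] \<noteq> [a, b, c, d, e, f]"
    using balanced assms by auto
  ultimately have "cn_move 6 3 [a, b, c, d, e, f] [a', b', c', d', e', f']"
    unfolding cn_move_6_3_iff using ad(1,2) eb(1,2) cf(1,2) by blast
  with balanced show ?thesis
    by blast
qed

text \<open>Around the circle, removals alternately lower and raise a difference. Two neighbours in
  the arc thus bound the new common value from both sides by the old one, so nothing
  changes.\<close>

lemma cn_move_6_3_not_balanced:
  assumes "cn_move 6 3 [a, b, c, d, e, f] [a', b', c', d', e', f']"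
    and "a + b = d + e" "b + c = e + f"
  shows "\<not> (a' + b' = d' + e' \<and> b' + c' = e' + f')"
  using assms unfolding cn_move_6_3_iff by (elim conjE disjE; simp; arith)

theorem theorem3p2:
  shows "cn_losing_positions 6 3 =
    {[a, b, c, d, e, f] | a b c d e f :: nat. a + b = d + e \<and> b + c = e + f}"
  (is "_ = ?A")
proof (rule cn_losing_positions_unique)
  fix p :: "nat list"
  have list6: "\<exists>a b c d e f. q = [a, b, c, d, e, f]" if "q \<in> cn_positions 6" for q
    using that by (auto simp: cn_positions_def numeral_eq_Suc length_Suc_conv)
  show "p \<in> ?A \<longleftrightarrow> p \<in> cn_positions 6 \<and> (\<forall>q. cn_move 6 3 p q \<longrightarrow> q \<notin> ?A)"
  proof
    assume "p \<in> ?A"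
    then obtain a b c d e f where p: "p = [a, b, c, d, e, f]"
      and bal: "a + b = d + e" "b + c = e + f"
      by blast
    have "q \<notin> ?A" if "cn_move 6 3 p q" for q
      using cn_move_6_3_not_balanced[OF _ bal] that unfolding p by blast
    then show "p \<in> cn_positions 6 \<and> (\<forall>q. cn_move 6 3 p q \<longrightarrow> q \<notin> ?A)"
      by (simp add: p cn_positions_def)
  next
    assume R: "p \<in> cn_positions 6 \<and> (\<forall>q. cn_move 6 3 p q \<longrightarrow> q \<notin> ?A)"
    then obtain a b c d e f where p: "p = [a, b, c, d, e, f]"
      using list6 by blast
    have "a + b = d + e \<and> b + c = e + f"
      using R ex_cn_move_6_3[of a b d e c f] unfolding p by blast
    then show "p \<in> ?A"
      unfolding p by blast
  qed
qed

end
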